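(* Let $(N,a)$ be one of the pairs $(28,-7)$, $(30,5)$, $(33,-11)$, $(35,5)$, and let $p\neq 2$ be a prime such that $a$ is a square modulo $p$. Then there exist infinitely many quadratic fields generated by a point on $X_0(N)$ (i.e. infinitely many distinct fields $\mathbb{Q}(\sqrt{f_N(u)})$, $u\in\mathbb{Z}$, with $f_N(u)$ not a square) in which $p$ ramifies.
   Context: The modular curve $X_0(N)$ is given by the hyperelliptic model $y^2=f_N(x)$ with $f_{28}=4x^6-12x^5+25x^4-30x^3+25x^2-12x+4$; $f_{30}=x^8+14x^7+79x^6+242x^5+441x^4+484x^3+316x^2+112x+16$; $f_{33}=x^8+10x^6-8x^5+47x^4-40x^3+82x^2-44x+33$; $f_{35}=x^8-4x^7-6x^6-4x^5-9x^4+4x^3-6x^2+4x+1$. A point $(x_0,\sqrt{f_N(x_0)})$ with $x_0\in\mathbb{Q}$ is defined over $\mathbb{Q}(\sqrt{f_N(x_0)})$. *)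

theory Defs
  imports
    Complex_Main
    "HOL-Computational_Algebra.Nth_Powers"
    "HOL-Algebra.Generated_Fields"
    "HOL-Algebra.Ideal_Product"
    "HOL-Algebra.Algebraic_Closure_Type"
    "HOL-Number_Theory.Residues"
begin

text \<open>
  The hyperelliptic model of $X_0(N)$ is $y^2 = $ \<open>f_X0 N x\<close>. It is polymorphic so that it can
  be evaluated both in the integers and in the complex numbers.
\<close>

definition f_X0 :: "nat \<Rightarrow> 'a::comm_ring_1 \<Rightarrow> 'a" where
  "f_X0 N x =
    (if N = 28 then 4*x^6 - 12*x^5 + 25*x^4 - 30*x^3 + 25*x^2 - 12*x + 4
     else if N = 30 then x^8 + 14*x^7 + 79*x^6 + 242*x^5 + 441*x^4 + 484*x^3 + 316*x^2 + 112*x + 16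
     else if N = 33 then x^8 + 10*x^6 - 8*x^5 + 47*x^4 - 40*x^3 + 82*x^2 - 44*x + 33
     else if N = 35 then x^8 - 4*x^7 - 6*x^6 - 4*x^5 - 9*x^4 + 4*x^3 - 6*x^2 + 4*x + 1
     else undefined)"

text \<open>
  Number fields are realised as subfields of the complex numbers, so that two of them are the same
  field iff they are equal as sets. A generated subfield contains $1$ and hence the rationals:
  \<open>rat_adjoin S\<close> is the field $\mathbb{Q}(S)$.
\<close>

definition rat_adjoin :: "complex set \<Rightarrow> complex set" where
  "rat_adjoin S = generate_field ring_of_type_algebra S"

definition ring_of_integers :: "complex set \<Rightarrow> complex ring" where
  "ring_of_integers K = ring_of_type_algebra \<lparr>carrier := {x \<in> K. algebraic_int x}\<rparr>"

text \<open>
  A rational prime $p$ ramifies in $K$ if $P^2$ divides $p\mathcal{O}_K$ for some prime ideal $P$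
  of $\mathcal{O}_K$, i.e. some ramification index $e(P|p)$ is at least $2$. The ideal $P$ is then
  automatically nonzero.
\<close>

definition ramifies_in :: "nat \<Rightarrow> complex set \<Rightarrow> bool" where
  "ramifies_in p K \<longleftrightarrow>
    (\<exists>P J. primeideal P (ring_of_integers K) \<and> ideal J (ring_of_integers K) \<and>
       PIdl\<^bsub>ring_of_integers K\<^esub> (of_nat p) =
         (P \<cdot>\<^bsub>ring_of_integers K\<^esub> P) \<cdot>\<^bsub>ring_of_integers K\<^esub> J)"

end

(*
  Each f_N is a product q h over Z, where q is a monic quadratic of discriminant a. If a is a square
  modulo p, then q has a root modulo p; outside finitely many p this root is simple and not a root
  of h, so that it lifts to some v for which p divides f_N(v) exactly once (for the remaining p such
  a v is exhibited). In K = Q(sqrt(f_N(v))) the integers whose norm is divisible by p then form a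
  prime ideal with square (p), so p ramifies. There are infinitely many primes l modulo which a is a
  square, so the Chinese remainder theorem yields a u for which f_N(u) is exactly divisible both by
  p and by an l that divides none of finitely many given values f_N(v); the field Q(sqrt(f_N(u)))
  differs from the fields Q(sqrt(f_N(v))).
*)
theory Submission
  imports Defs
begin

section \<open>Values of \<open>f_X0\<close> divisible exactly once by a given prime\<close>

lemma f_X0_of_int:
  assumes "N \<in> {28, 30, 33, 35}"
  shows "f_X0 N (of_int u :: complex) = of_int (f_X0 N u)"
  using assms by (auto simp: f_X0_def)

lemma cong_f_X0:
  assumes "N \<in> {28, 30, 33, 35}" "[u = v] (mod m)"
  shows "[f_X0 N u = f_X0 N (v :: int)] (mod m)"
  using assms(1) unfolding f_X0_def
  by (auto intro!: cong_add cong_diff cong_mult cong_pow cong_refl assms(2))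

text \<open>A square root of the discriminant modulo the odd prime \<open>p\<close> yields a root of
  \<open>q\<close> modulo \<open>p\<close>, and this root is simple because \<open>p\<close> does
  not divide the discriminant. The cofactor of \<open>q\<close> is congruent to
  \<open>s*x + t\<close> modulo \<open>q\<close>, and the number in \<open>R\<close> is the
  resultant of \<open>q\<close> and \<open>s*x + t\<close>; hence \<open>p\<close> does not divide
  the cofactor at the root.\<close>

lemma exact_divisor_quadratic_product:
  fixes b c p s t :: int and f A :: "int \<Rightarrow> int"
  defines "q \<equiv> (\<lambda>x. x^2 + b*x + c)"
  assumes f: "\<And>x. f x = q x * (A x * q x + (s*x + t))"
    and p: "prime p" "p \<noteq> 2" and D: "\<not> p dvd b^2 - 4*c" "QuadRes p (b^2 - 4*c)"
    and R: "\<not> p dvd t^2 - s*t*b + s^2*c"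
  shows "\<exists>v. p dvd f v \<and> \<not> p^2 dvd f v"
proof -
  obtain y where y: "[y^2 = b^2 - 4*c] (mod p)"
    using D(2) by (auto simp: QuadRes_def)
  have "odd p" using p prime_odd_int[of p] prime_ge_2_int[of p] by force
  then obtain k where k: "p = 2*k + 1" by (elim oddE)
  have root: "p dvd q v" if "[2*v + b = y] (mod p)" for v
  proof -
    have "[(2*v+b)^2 = b^2 - 4*c] (mod p)"
      using cong_trans[OF cong_pow[OF that] y] .
    then have "p dvd 4 * q v"
      by (simp add: cong_iff_dvd_diff q_def power2_eq_square algebra_simps)
    moreover have "coprime p 4"
      using \<open>odd p\<close> using coprime_power_right_iff[of p 2 2] by simp
    ultimately show ?thesis using coprime_dvd_mult_right_iff by blast
  qed
  \<comment> \<open>Modulo \<open>p = 2*k + 1\<close> the inverse of 2 is \<open>k + 1\<close>, so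
    this is the root \<open>(y - b) / 2\<close>.\<close>
  define u where "u = (y - b) * (k + 1)"
  have "2*u + b - y = (y - b) * p" by (simp add: u_def k algebra_simps)
  then have uy: "[2*u + b = y] (mod p)"
    by (simp add: cong_iff_dvd_diff)
  have upy: "[2*(u+p) + b = y] (mod p)"
  proof -
    have "2*(u+p) + b - y = (y - b + 2) * p" using \<open>2*u + b - y = _\<close> by (simp add: algebra_simps)
    then show ?thesis by (simp add: cong_iff_dvd_diff)
  qed
  have simple: "\<not> p dvd 2*u + b"
  proof
    assume "p dvd 2*u + b"
    then have "p dvd y" using uy cong_dvd_iff by blast
    then have "p dvd y^2" by (simp add: power2_eq_square)
    then show False using y D(1) cong_dvd_iff by blast
  qed
  have "\<exists>v. p dvd q v \<and> \<not> p^2 dvd q v"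
  proof (cases "p^2 dvd q u")
    case True
    \<comment> \<open>Taylor expansion with derivative \<open>2*u + b\<close>: since
      \<open>p\<close> does not divide the derivative, \<open>p^2\<close> cannot divide the values
      at both \<open>u\<close> and \<open>u + p\<close>.\<close>
    have "q (u+p) = q u + p^2 + p * (2*u + b)"
      by (simp add: q_def power2_eq_square algebra_simps)
    moreover have "\<not> p^2 dvd p * (2*u + b)"
      using simple p by (simp add: power2_eq_square)
    ultimately have "\<not> p^2 dvd q (u+p)" using True
      by (metis dvd_add_right_iff dvd_add dvd_refl)
    then show ?thesis using root upy by blast
  qed (use root uy in blast)
  then obtain v where v: "p dvd q v" "\<not> p^2 dvd q v" by blast
  have "\<not> p dvd s*v + t"
  proof
    assume "p dvd s*v + t"
    \<comment> \<open>The resultant as a combination of \<open>s*v + t\<close> and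
      \<open>q v\<close>.\<close>
    then have "p dvd (s*v + t) * (t - s*b - s*v) + s^2 * q v" using v(1) by simp
    also have "\<dots> = t^2 - s*t*b + s^2*c"
      by (simp add: q_def power2_eq_square algebra_simps)
    finally show False using R by simp
  qed
  then have "\<not> p dvd A v * q v + (s*v + t)" (is "\<not> p dvd ?h")
    using v(1) by (simp add: dvd_add_right_iff)
  then have "coprime (p^2) ?h" using p(1) prime_imp_coprime by auto
  then have "\<not> p^2 dvd q v * ?h"
    using v(2) coprime_dvd_mult_left_iff by blast
  moreover have "p dvd q v * ?h" using v(1) by simp
  ultimately show ?thesis unfolding f by blast
qed

text \<open>In each case \<open>q\<close> has discriminant \<open>a\<close>, and \<open>A\<close>
  and \<open>s*x + t\<close> are the quotient and the remainder of the cofactor on division by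
  \<open>q\<close>. Up to sign the resultants are \<open>2^6\<close>, \<open>2^4 * 3^2\<close>,
  \<open>2^4 * 3^3\<close> and \<open>2^4 * 7^2\<close>, so only the odd primes dividing these or
  \<open>a\<close> need separate treatment.\<close>

lemma exact_divisor_f_X0:
  assumes Na: "(N, a) \<in> {(28, -7), (30, 5), (33, -11), (35, 5 :: int)}"
    and p: "prime p" "p \<noteq> 2" "QuadRes p a"
  shows "\<exists>v. p dvd f_X0 N v \<and> \<not> p^2 dvd f_X0 N v"
proof -
  \<comment> \<open>The primes 3 and 7 divide the resultants for \<open>N = 30\<close> and
    \<open>N = 35\<close>; they are excluded because 5 is not a square modulo them.\<close>
  have nonres: "\<not> QuadRes 3 5" "\<not> QuadRes 7 5"
  proof -
    have "y^2 mod 3 \<noteq> 5 mod 3" for y :: int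
    proof -
      have "y mod 3 = 0 \<or> y mod 3 = 1 \<or> y mod 3 = 2" by presburger
      then show ?thesis by (elim disjE) (simp_all add: power_mod[of y 3, symmetric])
    qed
    then show "\<not> QuadRes 3 5" by (simp add: QuadRes_def cong_def)
    have "y^2 mod 7 \<noteq> 5 mod 7" for y :: int
    proof -
      have "y mod 7 = 0 \<or> y mod 7 = 1 \<or> y mod 7 = 2 \<or> y mod 7 = 3 \<or> y mod 7 = 4 \<or> y mod 7 = 5 \<or> y mod 7 = 6" by presburger
      then show ?thesis by (elim disjE) (simp_all add: power_mod[of y 7, symmetric])
    qed
    then show "\<not> QuadRes 7 5" by (simp add: QuadRes_def cong_def)
  qed
  have dvd: "p = m" if "prime m" "p dvd m" for m :: int
    using that p(1) by (simp add: primes_dvd_imp_eq)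
  have pow: "\<not> p dvd m ^ k" if "prime m" "p \<noteq> m" for m :: int and k
    using that dvd p(1) prime_dvd_power by blast
  have primes: "prime (2::int)" "prime (3::int)" "prime (5::int)" "prime (7::int)" "prime (11::int)"
    by simp_all
  consider "N = 28" "a = -7" | "N = 30" "a = 5" | "N = 33" "a = -11" | "N = 35" "a = 5"
    using Na by auto
  then show ?thesis
  proof cases
    case 1
    consider "p = 7" | "p \<noteq> 7" by blast
    then show ?thesis
    proof cases
      case 1
      \<comment> \<open>The value at 2 is \<open>112 = 2^4 * 7\<close>. For \<open>a = 5\<close> the
        witnesses below give \<open>1705 = 5 * 11 * 31\<close> when \<open>N = 30\<close> and
        \<open>-895 = -5 * 179\<close> when \<open>N = 35\<close>.\<close>
      then show ?thesis using \<open>N = 28\<close> by (intro exI[of _ 2]) (simp add: f_X0_def)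
    next
      case 2
      then have "\<not> p dvd 2^6" "\<not> p dvd 7"
        using pow primes dvd p \<open>a = -7\<close> unfolding prime_dvd_mult_iff[OF p(1)] by blast+
      then show ?thesis
        using p \<open>a = -7\<close> \<open>N = 28\<close>
        by (intro exact_divisor_quadratic_product[where b = "-1" and c = "2" and s = "0" and t = 8
              and A = "\<lambda>v. 4*v^2 - 4*v - 3"])
          (simp_all add: f_X0_def algebra_simps eval_nat_numeral)
    qed
  next
    case 2
    consider "p = 5" | "p \<noteq> 5" by blast
    then show ?thesis
    proof cases
      case 1
      then show ?thesis using \<open>N = 30\<close> by (intro exI[of _ 1]) (simp add: f_X0_def)
    next
      case 2
      then have "\<not> p dvd 2^4 * 3^2" "\<not> p dvd 5"
        using pow primes dvd p nonres \<open>a = 5\<close> unfolding prime_dvd_mult_iff[OF p(1)] by blast+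
      then show ?thesis
        using p \<open>a = 5\<close> \<open>N = 30\<close>
        by (intro exact_divisor_quadratic_product[where b = "3" and c = "1" and s = "24" and t = 12
              and A = "\<lambda>v. v^4 + 8*v^3 + 20*v^2 + 28*v + 4"])
          (simp_all add: f_X0_def algebra_simps eval_nat_numeral)
    qed
  next
    case 3
    \<comment> \<open>Here 3 divides the resultant and cannot be excluded, as -11 is a square modulo
      3. The value \<open>33 = 3 * 11\<close> at 0 serves both exceptional primes.\<close>
    consider "p = 3" | "p = 11" | "p \<noteq> 3" "p \<noteq> 11" by blast
    then show ?thesis
    proof cases
      case 1
      then show ?thesis using \<open>N = 33\<close> by (intro exI[of _ 0]) (simp add: f_X0_def)
    next
      case 2
      then show ?thesis using \<open>N = 33\<close> by (intro exI[of _ 0]) (simp add: f_X0_def)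
    next
      case 3
      then have "\<not> p dvd 2^4 * 3^3" "\<not> p dvd 11"
        using pow primes dvd p \<open>a = -11\<close> unfolding prime_dvd_mult_iff[OF p(1)] by blast+
      then show ?thesis
        using p \<open>a = -11\<close> \<open>N = 33\<close>
        by (intro exact_divisor_quadratic_product[where b = "-1" and c = "3" and s = "-8" and t = 20
              and A = "\<lambda>v. v^4 + 2*v^3 + 7*v^2 - 2*v - 3"])
          (simp_all add: f_X0_def algebra_simps eval_nat_numeral)
    qed
  next
    case 4
    consider "p = 5" | "p \<noteq> 5" by blast
    then show ?thesis
    proof cases
      case 1
      then show ?thesis using \<open>N = 35\<close> by (intro exI[of _ 2]) (simp add: f_X0_def)
    next
      case 2
      then have "\<not> p dvd 2^4 * 7^2" "\<not> p dvd 5"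
        using pow primes dvd p nonres \<open>a = 5\<close> unfolding prime_dvd_mult_iff[OF p(1)] by blast+
      then show ?thesis
        using p \<open>a = 5\<close> \<open>N = 35\<close>
        by (intro exact_divisor_quadratic_product[where b = "1" and c = "-1" and s = "-56" and t = 28
              and A = "\<lambda>v. v^4 - 6*v^3 + 7*v^2 - 22*v + 29"])
          (simp_all add: f_X0_def algebra_simps eval_nat_numeral)
    qed
  qed
qed

section \<open>Rational squares, and integrality of quadratic numbers by trace and norm\<close>

text \<open>For \<open>e\<close> nonzero the \<open>p\<close>-adic valuation is even on the left and
  1 on the right. The case \<open>m = 1\<close> makes square roots irrational; general
  \<open>m\<close> serves to tell quadratic fields apart.\<close>

lemma rat_square_times_nonmultiple:
  fixes e :: rat and p d m :: int
  assumes p: "prime p" "p dvd d" "\<not> p^2 dvd d" "\<not> p dvd m"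
  shows "e^2 * of_int m \<noteq> of_int d"
proof
  assume eq: "e^2 * of_int m = of_int d"
  obtain a b where e: "e = of_int a / of_int b" "b > 0" "coprime a b"
    by (metis quotient_of_div quotient_of_denom_pos quotient_of_coprime surj_pair)
  have "of_int (a^2 * m) = (of_int (d * b^2) :: rat)"
    using eq e by (simp add: field_simps)
  then have ab: "a^2 * m = d * b^2" by (simp only: of_int_eq_iff)
  then have "p dvd a^2 * m" using p by simp
  then have "p dvd a" using p by (simp add: prime_dvd_mult_iff prime_dvd_power_iff)
  then have "p^2 dvd d * b^2" using ab by (metis dvd_mult2 dvd_power_same)
  moreover have "coprime (p^2) (b^2)"
    using \<open>p dvd a\<close> e(3) by (meson coprime_divisors coprime_power_left_iff coprime_power_right_iff dvd_refl)
  ultimately show False using p(3) coprime_dvd_mult_left_iff by blast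
qed

lemma rat_square_of_int_Ints:
  fixes e :: rat
  assumes "e^2 = of_int k"
  shows "e \<in> \<int>"
proof -
  have "algebraic_int e"
    by (rule algebraic_int_root[where p = "monom 1 2" and y = "of_int k"])
       (use assms in \<open>auto simp: poly_monom degree_monom_eq\<close>)
  then show ?thesis
  by (intro rational_algebraic_int_is_int) (auto simp: Rats_def image_iff intro: exI[of _ e])
qed

text \<open>Clearing denominators turns the equation into an integer polynomial \<open>g\<close>
  with leading coefficient \<open>t2 * n2\<close>. Once its primitive part has leading coefficient 1
  or -1, the content of \<open>g\<close> is \<open>t2 * n2\<close> up to sign, so this product
  divides every coefficient of \<open>g\<close> and both denominators cancel.\<close>

lemma quadratic_algebraic_int_coeffs:
  fixes x :: complex and t n :: rat
  assumes x: "algebraic_int x" "x \<notin> \<rat>" and eq: "x^2 = of_rat t * x - of_rat n"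
  shows "t \<in> \<int> \<and> n \<in> \<int>"
proof -
  obtain t1 t2 where t: "t = of_int t1 / of_int t2" "t2 > 0"
    by (metis quotient_of_div quotient_of_denom_pos surj_pair)
  obtain n1 n2 where n: "n = of_int n1 / of_int n2" "n2 > 0"
    by (metis quotient_of_div quotient_of_denom_pos surj_pair)
  define g where "g = [:n1 * t2, - (t1 * n2), t2 * n2:]"
  have g: "degree g = 2" "g \<noteq> 0" using t n by (auto simp: g_def)
  define m where "m = primitive_part g"
  have gm: "g = smult (content g) m" by (simp add: m_def)
  have m: "degree m = 2" "m \<noteq> 0" "content m = 1" using g by (auto simp: m_def)
  have poly_g: "poly (map_poly of_int g) x = of_int (t2 * n2) * (x^2 - of_rat t * x + of_rat n)"
  proof -
    have "of_int t1 = of_rat t * (of_int t2 :: complex)" "of_int n1 = of_rat n * (of_int n2 :: complex)"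
      using t n by (simp_all add: of_rat_divide)
    then show ?thesis
      by (simp add: g_def map_poly_pCons power2_eq_square algebra_simps)
  qed
  have hom_smult: "map_poly of_int (smult k f) = smult (of_int k) (map_poly of_int f :: complex poly)"
    for k f by (intro poly_eqI) (simp add: coeff_map_poly)
  have hom_mult: "map_poly of_int (f * h) = (map_poly of_int f * map_poly of_int h :: complex poly)"
    for f h by (intro poly_eqI) (simp add: coeff_map_poly coeff_mult)
  have hom_add: "map_poly of_int (f + h) = (map_poly of_int f + map_poly of_int h :: complex poly)"
    for f h by (intro poly_eqI) (simp add: coeff_map_poly)
  have "of_int (content g) * poly (map_poly of_int m) x = 0"
    using poly_g eq by (subst (asm) gm) (simp add: hom_smult)
  then have mx: "poly (map_poly of_int m) x = 0"
    using g by simp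
  obtain f :: "int poly" where f: "poly (map_poly of_int f) x = 0" "lead_coeff f = 1"
    using x(1) by (auto simp: algebraic_int_altdef_ipoly)
  \<comment> \<open>Gauss: the primitive quadratic \<open>m\<close> divides the monic \<open>f\<close> already over the integers, so its leading coefficient is a unit.\<close>
  obtain q r where qr: "pseudo_divmod f m = (q, r)" by force
  define k where "k = coeff m 2 ^ (Suc (degree f) - 2)"
  have k: "k \<noteq> 0" using m by (simp add: k_def) (metis leading_coeff_0_iff)
  have div: "smult k f = m * q + r" "r = 0 \<or> degree r < 2"
    using pseudo_divmod[OF m(2) qr] m(1) by (simp_all add: k_def)
  have "poly (map_poly of_int r) x = 0"
    using arg_cong[OF div(1), of "\<lambda>f. poly (map_poly of_int f) x"] mx f(1)
    by (simp add: hom_smult hom_mult hom_add)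
  moreover obtain r0 r1 where r: "r = [:r0, r1:]"
  proof
    have "degree r \<le> 1" using div(2) by auto
    then show "r = [:coeff r 0, coeff r 1:]"
      by (intro poly_eqI) (auto simp: coeff_pCons coeff_eq_0 split: nat.splits)
  qed
  ultimately have r01: "of_int r0 + x * of_int r1 = 0"
    by (simp add: map_poly_pCons)
  \<comment> \<open>The remainder is at most linear and vanishes at the irrational \<open>x\<close>,
    so it is zero.\<close>
  have "r1 = 0"
  proof (rule ccontr)
    assume "r1 \<noteq> 0"
    then have "x = - of_int r0 / of_int r1" using r01 by (simp add: field_simps add_eq_0_iff)
    then show False using x(2) by auto
  qed
  then have "smult k f = m * q" using r01 div(1) r by simp
  \<comment> \<open>Content is multiplicative and \<open>m\<close> is primitive, so \<open>q\<close>
    has content \<open>\<bar>k\<bar>\<close> and the factor \<open>k\<close> introduced by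
    pseudo-division can be cancelled.\<close>
  moreover have "content f = 1"
    using f(2) by (metis content_dvd_coeff is_unit_normalize normalize_content)
  ultimately have "content q = \<bar>k\<bar>"
    by (metis content_mult content_smult m(3) mult_1 mult_1_right normalize_int_def abs_mult abs_1)
  then obtain h where "q = smult k h"
    by (metis const_poly_dvd_iff_dvd_content abs_dvd_iff dvd_abs_iff dvd_refl dvdE mult_smult_left smult_one)
  then have "f = m * h" using \<open>smult k f = m * q\<close> k
    by (metis mult_smult_right smult_cancel)
  then have "lead_coeff m dvd 1" using f(2) by (metis dvd_triv_left lead_coeff_mult)
  then have unit: "\<bar>coeff m 2\<bar> = 1" using m(1) by simp
  have gc: "\<bar>content g\<bar> = \<bar>t2 * n2\<bar>"
  proof -
    have "t2 * n2 = content g * coeff m 2"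
      using arg_cong[OF gm, of "\<lambda>f. coeff f 2"] by (simp add: g_def numeral_2_eq_2)
    then show ?thesis using unit by (metis abs_mult mult.right_neutral)
  qed
  have "t2 * n2 dvd content g" using gc by (metis abs_dvd_iff dvd_abs_iff dvd_refl)
  then have *: "t2 * n2 dvd coeff g i" for i
    using content_dvd_coeff dvd_trans by blast
  have "t2 dvd t1" "n2 dvd n1"
    using *[of 1] *[of 0] t n by (auto simp: g_def mult.commute)
  then show ?thesis using t n by (auto elim!: dvdE)
qed
text \<open>Trace and norm of $r + s\sqrt{d}$ are integers; for $d$ not a square this characterises integrality.\<close>

definition quad_integral :: "int \<Rightarrow> rat \<Rightarrow> rat \<Rightarrow> bool" where
  "quad_integral d r s \<longleftrightarrow> 2*r \<in> \<int> \<and> r^2 - of_int d * s^2 \<in> \<int>"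

text \<open>Both sides of the second conclusion are $(4 d s s')^2$, so $4 d s s'$ is an integer even if $s$ has a denominator.\<close>

lemma quad_integral_trace:
  assumes x: "2*r = of_int A" "r^2 - of_int d * s^2 = of_int n"
    and y: "2*r' = of_int A'" "r'^2 - of_int d * s'^2 = of_int n'"
  obtains T where "2 * (r*r' + of_int d*s*s') = (of_int T :: rat)"
    and "(2*T - A*A')^2 = (A^2 - 4*n) * (A'^2 - 4*n')"
proof -
  define C where "C = 4 * of_int d * s * s'"
  have ds: "4 * of_int d * s^2 = (of_int (A^2 - 4*n) :: rat)"
    "4 * of_int d * s'^2 = (of_int (A'^2 - 4*n') :: rat)"
    by (simp_all add: x[symmetric] y[symmetric] power2_eq_square algebra_simps)
  have "C^2 = (4 * of_int d * s^2) * (4 * of_int d * s'^2)"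
    by (simp add: C_def power2_eq_square)
  also have "\<dots> = of_int ((A^2 - 4*n) * (A'^2 - 4*n'))" by (simp only: ds of_int_mult)
  finally have C2: "C^2 = of_int ((A^2 - 4*n) * (A'^2 - 4*n'))" .
  then have "C \<in> \<int>" by (rule rat_square_of_int_Ints)
  then obtain c where c: "C = of_int c" by (elim Ints_cases)
  have c2: "c^2 = (A^2 - 4*n) * (A'^2 - 4*n')"
    using C2 unfolding c by (metis of_int_eq_iff of_int_power)
  \<comment> \<open>The terms \<open>4*n\<close> and \<open>4*n'\<close> do not affect parity, so
    \<open>c\<close> and \<open>A * A'\<close> have the same parity and the trace
    \<open>(A*A' + c) / 2\<close> of the product is an integer.\<close>
  have "even (c^2) \<longleftrightarrow> even (A * A')" unfolding c2 by simp
  then have "even (A*A' + c)" by simp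
  then obtain T where T: "A*A' + c = 2*T" by (elim evenE)
  have "2 * (2 * (r*r' + of_int d*s*s')) = (2*r) * (2*r') + C"
    by (simp add: C_def algebra_simps)
  also have "\<dots> = of_int (A*A' + c)" by (simp add: x y c)
  finally have "2 * (r*r' + of_int d*s*s') = of_int T" by (simp add: T)
  moreover have "(2*T - A*A')^2 = (A^2 - 4*n) * (A'^2 - 4*n')" by (simp add: T[symmetric] c2)
  ultimately show ?thesis using that by blast
qed

lemma quad_norm_mult:
  "(r*r' + of_int d*s*s')^2 - of_int d * (r*s' + s*r')^2
     = (r^2 - of_int d * s^2) * (r'^2 - of_int d * s'^2)" for r :: "'a :: comm_ring_1"
  by (simp add: power2_eq_square algebra_simps)

text \<open>The cross term is the trace of the product with the conjugate, whence the sign of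
  \<open>s'\<close>; results on traces of products thus apply to sums.\<close>

lemma quad_norm_add:
  "(r + r')^2 - of_int d * (s + s')^2
     = (r^2 - of_int d * s^2) + (r'^2 - of_int d * s'^2) + 2 * (r*r' + of_int d*s*(-s'))"
  for r :: "'a :: comm_ring_1"
  by (simp add: power2_eq_square algebra_simps)

lemma quad_integral_mult:
  assumes "quad_integral d r s" "quad_integral d r' s'"
  shows "quad_integral d (r*r' + of_int d*s*s') (r*s' + s*r')"
proof -
  obtain A n A' n' where "2*r = of_int A" "r^2 - of_int d * s^2 = of_int n"
     "2*r' = of_int A'" "r'^2 - of_int d * s'^2 = of_int n'"
    using assms by (auto simp: quad_integral_def elim!: Ints_cases)
  from quad_integral_trace[OF this] obtain T where "2 * (r*r' + of_int d*s*s') = of_int T" .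
  then show ?thesis
    using assms unfolding quad_integral_def quad_norm_mult by (auto simp: Ints_of_int)
qed

lemma quad_integral_add:
  assumes "quad_integral d r s" "quad_integral d r' s'"
  shows "quad_integral d (r + r') (s + s')"
proof -
  have y: "quad_integral d r' (-s')" using assms by (simp add: quad_integral_def)
  then have "2 * (r*r' + of_int d*s*(-s')) \<in> \<int>"
    using quad_integral_mult[OF assms(1) y] by (simp only: quad_integral_def)
  then show ?thesis
    using assms unfolding quad_integral_def quad_norm_add distrib_left by auto
qed

section \<open>The quadratic field generated by a square root of \<open>d\<close>\<close>

text \<open>Since \<open>d\<close> will be a value of \<open>f_X0\<close>, it may have square
  factors, and integers cannot be classified by \<open>d\<close> modulo 4. That \<open>p\<close>
  divides \<open>d\<close> exactly once already makes \<open>w\<close> irrational.\<close>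

locale ramified_sqrt =
  fixes d p :: int and w :: complex
  assumes w2: "w^2 = of_int d"
    and prime: "prime p" and p2: "p \<noteq> 2" and pd: "p dvd d" "\<not> p^2 dvd d"
begin

definition emb :: "rat \<Rightarrow> rat \<Rightarrow> complex" where
  "emb r s = of_rat r + of_rat s * w"

lemma emb_add: "emb r s + emb r' s' = emb (r + r') (s + s')"
  by (simp add: emb_def of_rat_add algebra_simps)

lemma emb_minus: "- emb r s = emb (-r) (-s)"
  by (simp add: emb_def of_rat_minus)

lemma emb_mult: "emb r s * emb r' s' = emb (r*r' + of_int d*s*s') (r*s' + s*r')"
proof -
  have "emb r s * emb r' s' = of_rat r * of_rat r' + of_rat s * of_rat s' * w^2
      + (of_rat r * of_rat s' + of_rat s * of_rat r') * w"
    by (simp add: emb_def power2_eq_square algebra_simps)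
  then show ?thesis by (simp add: w2 emb_def of_rat_add of_rat_mult algebra_simps)
qed

lemma emb_of_int: "of_int k = emb (of_int k) 0"
  by (simp add: emb_def)

lemma emb_1: "1 = emb 1 0" and emb_w: "w = emb 0 1"
  by (simp_all add: emb_def)

lemma square_rat_neq: "e^2 \<noteq> of_int d" for e :: rat
proof -
  have "\<not> p dvd 1" using prime by auto
  from rat_square_times_nonmultiple[OF prime pd this, of e] show ?thesis by simp
qed

lemma w_neq_of_rat: "w \<noteq> of_rat e"
proof
  assume "w = of_rat e"
  then have "of_rat (e^2) = (of_rat (of_int d) :: complex)" using w2 by (simp add: of_rat_power)
  then show False using square_rat_neq by (metis of_rat_eq_iff)
qed

lemma emb_in_Rats_iff: "emb r s \<in> \<rat> \<longleftrightarrow> s = 0"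
proof
  assume "emb r s \<in> \<rat>"
  then obtain e where e: "of_rat r + of_rat s * w = of_rat e"
    unfolding emb_def Rats_def by auto
  show "s = 0"
  proof (rule ccontr)
    assume "s \<noteq> 0"
    then have "w = of_rat ((e - r) / s)"
      using e by (simp add: of_rat_divide of_rat_diff field_simps)
    then show False using w_neq_of_rat by blast
  qed
qed (simp add: emb_def)

lemma emb_inject: "emb r s = emb r' s' \<longleftrightarrow> r = r' \<and> s = s'"
proof
  assume eq: "emb r s = emb r' s'"
  then have "emb r s + - emb r' s' \<in> \<rat>" by simp
  then have "s = s'" unfolding emb_minus emb_add emb_in_Rats_iff by simp
  then show "r = r' \<and> s = s'" using eq by (simp add: emb_def)
qed simp

lemma norm_nonzero: "emb r s \<noteq> 0 \<Longrightarrow> r^2 - of_int d * s^2 \<noteq> 0"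
proof
  assume "emb r s \<noteq> 0" "r^2 - of_int d * s^2 = 0"
  show False
  proof (cases "s = 0")
    case False
    then have "(r/s)^2 = of_int d" using \<open>r^2 - _ = 0\<close> by (simp add: field_simps)
    then show False using square_rat_neq by blast
  qed (use \<open>emb r s \<noteq> 0\<close> \<open>r^2 - _ = 0\<close> in \<open>simp add: emb_def\<close>)
qed

lemma inverse_emb:
  assumes "emb r s \<noteq> 0"
  shows "\<exists>r' s'. inverse (emb r s) = emb r' s'"
proof -
  define n where "n = r^2 - of_int d * s^2"
  have "n \<noteq> 0" using norm_nonzero[OF assms] by (simp add: n_def)
  then have "emb r s * emb (r/n) (- s/n) = 1"
    unfolding emb_mult emb_1 emb_inject
    by (simp add: field_simps) (simp add: n_def power2_eq_square)
  then show ?thesis by (metis inverse_unique)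
qed

lemma algebraic_int_emb_iff: "algebraic_int (emb r s) \<longleftrightarrow> quad_integral d r s"
proof
  have eq: "(emb r s)^2 = of_rat (2*r) * emb r s - of_rat (r^2 - of_int d * s^2)"
    by (simp add: emb_def of_rat_mult of_rat_diff of_rat_power power2_eq_square algebra_simps
        w2[unfolded power2_eq_square])
  show "quad_integral d r s" if "algebraic_int (emb r s)"
  proof (cases "s = 0")
    case True
    then have "emb r s \<in> \<int>"
      using that emb_in_Rats_iff rational_algebraic_int_is_int by blast
    then obtain k where "of_rat r = (of_int k :: complex)" using True by (auto simp: emb_def elim: Ints_cases)
    then have "r = of_int k" by (metis of_rat_eq_iff of_rat_of_int_eq)
    then show ?thesis using True by (simp add: quad_integral_def)
  next
    case False
    then show ?thesis
      using quadratic_algebraic_int_coeffs[OF that _ eq] by (simp add: emb_in_Rats_iff quad_integral_def)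
  qed
  assume "quad_integral d r s"
  then obtain A n where An: "2*r = of_int A" "r^2 - of_int d * s^2 = of_int n"
    by (auto simp: quad_integral_def elim!: Ints_cases)
  show "algebraic_int (emb r s)"
  proof
    show "lead_coeff [:of_int n, - of_int A, 1 :: complex:] = 1" by simp
    show "\<forall>i. coeff [:of_int n, - of_int A, 1 :: complex:] i \<in> \<int>"
      by (auto simp: coeff_pCons split: nat.splits)
    show "poly [:of_int n, - of_int A, 1:] (emb r s) = 0"
      using eq unfolding An by (simp add: power2_eq_square algebra_simps)
  qed
qed

lemma rat_adjoin_sqrt: "rat_adjoin {w} = {emb r s | r s. True}"
proof
  let ?R = "ring_of_type_algebra :: complex ring"
  interpret R: field ?R by (rule field_from_type_algebra)
  have simps: "\<ominus>\<^bsub>?R\<^esub> x = - x" for x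
    by (rule R.minus_equality) (simp_all add: ring_of_type_algebra_def)
  have inv: "inv\<^bsub>?R\<^esub> x = inverse x" if "x \<noteq> 0" for x
    by (rule R.comm_inv_char) (use that in \<open>simp_all add: ring_of_type_algebra_def\<close>)
  have "generate_field ?R {w} \<subseteq> {emb r s | r s. True}"
  proof
    fix x assume "x \<in> generate_field ?R {w}"
    then show "x \<in> {emb r s | r s. True}"
    proof (induction rule: generate_field.induct)
      case one then show ?case using emb_1 by (auto simp: ring_of_type_algebra_def)
    next case (incl h) then show ?case using emb_w by auto
    next case (a_inv h) then show ?case by (auto simp: simps emb_minus emb_inject)
    next case (m_inv h)
      then have "h \<noteq> 0" by (simp add: ring_of_type_algebra_def)
      then show ?case using inverse_emb m_inv by (auto simp: inv)
    next case (eng_add h1 h2) then show ?case by (auto simp: ring_of_type_algebra_def emb_add emb_inject)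
    next case (eng_mult h1 h2) then show ?case by (auto simp: ring_of_type_algebra_def emb_mult emb_inject)
    qed
  qed
  then show "rat_adjoin {w} \<subseteq> {emb r s | r s. True}" by (simp add: rat_adjoin_def)
  let ?G = "generate_field ?R {w}"
  have add: "x + y \<in> ?G" and mult: "x * y \<in> ?G" if "x \<in> ?G" "y \<in> ?G" for x y
    using generate_field.eng_add[OF that] generate_field.eng_mult[OF that]
    by (simp_all add: ring_of_type_algebra_def)
  have minus: "- x \<in> ?G" if "x \<in> ?G" for x
    using generate_field.a_inv[OF that] by (simp add: simps)
  have inverse: "inverse x \<in> ?G" if "x \<in> ?G" "x \<noteq> 0" for x
    using generate_field.m_inv[of x ?R] that by (simp add: inv) (simp add: ring_of_type_algebra_def)
  have one: "1 \<in> ?G"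
    using generate_field.one[of ?R] by (simp add: ring_of_type_algebra_def)
  have int: "of_int k \<in> ?G" for k
  proof (induction k rule: int_induct[of _ 0])
    case base
    show ?case using add[OF one minus[OF one]] by simp
  next
    case (step1 i)
    then show ?case using add[OF _ one] by simp
  next
    case (step2 i)
    then show ?case using add[OF _ minus[OF one]] by simp
  qed
  have rat: "of_rat x \<in> ?G" for x
  proof -
    obtain a b where x: "x = of_int a / of_int b" "b > 0"
      by (metis quotient_of_div quotient_of_denom_pos surj_pair)
    have "of_rat x = (of_int a * inverse (of_int b) :: complex)"
      unfolding x(1) of_rat_divide by (simp add: divide_inverse)
    then show ?thesis
      using mult[OF int inverse[OF int], of b a] x(2) by simp
  qed
  have "w \<in> ?G" by (rule generate_field.incl) simp
  then show "{emb r s | r s. True} \<subseteq> rat_adjoin {w}"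
    using add mult rat by (auto simp: rat_adjoin_def emb_def)
qed

lemma carrier_ring_of_integers:
  "carrier (ring_of_integers (rat_adjoin {w})) = {emb r s | r s. quad_integral d r s}"
  by (force simp: ring_of_integers_def rat_adjoin_sqrt algebraic_int_emb_iff)

section \<open>The prime ideal above \<open>p\<close> and its square\<close>

text \<open>The integer \<open>(A^2 - 4*n) * d\<close> is the square of \<open>2*s*d\<close>. Being
  divisible by \<open>p\<close>, it is divisible by \<open>p^2\<close>; as \<open>p\<close> divides
  \<open>d\<close> only once, \<open>p\<close> divides \<open>A^2 - 4*n\<close>, hence
  \<open>A\<close>.\<close>

lemma norm_dvd_imp_trace_dvd:
  fixes r s :: rat
  assumes A: "2*r = of_int A" and n: "r^2 - of_int d * s^2 = of_int n" and "p dvd n"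
  shows "p dvd A"
proof -
  have "of_int (A^2 - 4*n) * of_int d = (2 * s * of_int d :: rat)^2"
    by (simp add: A[symmetric] n[symmetric] power2_eq_square algebra_simps)
  then have eq: "(2 * s * of_int d)^2 = (of_int ((A^2 - 4*n) * d) :: rat)" by simp
  then obtain g where g: "2 * s * of_int d = (of_int g :: rat)"
    using rat_square_of_int_Ints by (blast elim: Ints_cases)
  then have g2: "g^2 = (A^2 - 4*n) * d" using eq unfolding g by (metis of_int_eq_iff of_int_power)
  then have "p dvd g^2" using pd by simp
  then have "p dvd g" using prime prime_dvd_power by blast
  then have "p^2 dvd (A^2 - 4*n) * d" using g2 by (metis dvd_power_same)
  moreover obtain e where e: "d = p * e" "\<not> p dvd e"
    using pd by (auto simp: power2_eq_square)
  moreover have "p \<noteq> 0" using prime by auto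
  ultimately have "p dvd (A^2 - 4*n) * e"
    by (simp add: power2_eq_square mult.left_commute)
  then have "p dvd A^2 - 4*n" using e prime by (simp add: prime_dvd_mult_iff)
  then have "p dvd A^2" using \<open>p dvd n\<close> by (metis dvd_mult dvd_diff_right_iff dvd_diff_left_iff)
  then show ?thesis using prime prime_dvd_power by blast
qed

definition norm_multiple :: "rat \<Rightarrow> rat \<Rightarrow> bool" where
  "norm_multiple r s \<longleftrightarrow> (\<exists>n. r^2 - of_int d * s^2 = of_int n \<and> p dvd n)"

text \<open>Both traces are multiples of \<open>p\<close>, hence so are both factors
  \<open>A^2 - 4*n\<close> and \<open>A'^2 - 4*n'\<close>. Then \<open>p\<close> divides
  \<open>2*T - A*A'\<close>, so also \<open>2*T\<close>, and \<open>p\<close> is odd.\<close>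

lemma trace_mult_dvd:
  assumes "quad_integral d r s" "norm_multiple r s" "quad_integral d r' s'" "norm_multiple r' s'"
  obtains T where "2 * (r*r' + of_int d*s*s') = of_int T" "p dvd T"
proof -
  obtain A n A' n' where x: "2*r = of_int A" "r^2 - of_int d * s^2 = of_int n" "p dvd n"
     and y: "2*r' = of_int A'" "r'^2 - of_int d * s'^2 = of_int n'" "p dvd n'"
    using assms by (auto simp: quad_integral_def norm_multiple_def elim!: Ints_cases)
  have AA: "p dvd A" "p dvd A'" using norm_dvd_imp_trace_dvd x y by blast+
  obtain T where T: "2 * (r*r' + of_int d*s*s') = of_int T"
      "(2*T - A*A')^2 = (A^2 - 4*n) * (A'^2 - 4*n')"
    using quad_integral_trace[OF x(1,2) y(1,2)] .
  have "p dvd A^2 - 4*n" using AA x by (simp add: power2_eq_square)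
  then have "p dvd (2*T - A*A')^2" using T(2) by simp
  then have "p dvd 2*T - A*A'" using prime prime_dvd_power by blast
  then have "p dvd 2*T" using AA by (metis dvd_mult2 dvd_diff_left_iff)
  moreover have "\<not> p dvd 2" using prime p2 using primes_dvd_imp_eq[of p 2] by auto
  ultimately have "p dvd T" using prime by (simp add: prime_dvd_mult_iff)
  then show ?thesis using T that by blast
qed

text \<open>Described by norms rather than by the generators \<open>p\<close> and \<open>w\<close>:
  primality then follows from multiplicativity of the norm, and the work lies in closure under
  addition.\<close>

definition ramified_ideal :: "complex set" where
  "ramified_ideal = {emb r s | r s. quad_integral d r s \<and> norm_multiple r s}"

abbreviation "OK \<equiv> ring_of_integers (rat_adjoin {w})"

lemma OK_ops: "monoid.mult OK = (*)" "add OK = (+)" "one OK = 1" "zero OK = 0"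
  by (simp_all add: ring_of_integers_def ring_of_type_algebra_def fun_eq_iff)

lemma OK_add: "x + y \<in> carrier OK" and OK_mult: "x * y \<in> carrier OK"
  if "x \<in> carrier OK" "y \<in> carrier OK"
  using that quad_integral_add quad_integral_mult
  unfolding carrier_ring_of_integers by (auto simp: emb_add emb_mult) blast+

lemma quad_integral_of_int: "quad_integral d (of_int k) 0"
  by (simp add: quad_integral_def)

lemma OK_of_int: "of_int k \<in> carrier OK"
  unfolding carrier_ring_of_integers using emb_of_int quad_integral_of_int by blast

lemma OK_minus: "- x \<in> carrier OK" if "x \<in> carrier OK"
  using OK_mult[OF OK_of_int[of "-1"] that] by simp

lemma cring_OK: "cring OK"
proof (rule cringI)
  show "abelian_group OK"
  proof (rule abelian_groupI)
    fix x assume "x \<in> carrier OK"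
    then show "\<exists>y\<in>carrier OK. y \<oplus>\<^bsub>OK\<^esub> x = \<zero>\<^bsub>OK\<^esub>"
      using OK_minus by (intro bexI[of _ "- x"]) (simp_all add: OK_ops)
  qed (use OK_of_int[of 0] OK_add in \<open>auto simp: OK_ops algebra_simps\<close>)
  show "comm_monoid OK"
    by (rule comm_monoidI) (use OK_of_int[of 1] OK_mult in \<open>auto simp: OK_ops algebra_simps\<close>)
qed (simp add: OK_ops algebra_simps)

sublocale OK: cring OK by (rule cring_OK)

lemma OK_a_inv: "x \<in> carrier OK \<Longrightarrow> \<ominus>\<^bsub>OK\<^esub> x = - x"
  by (rule OK.minus_equality) (simp_all add: OK_ops OK_minus)

lemma norm_multiple_add:
  assumes "quad_integral d r s" "norm_multiple r s" "quad_integral d r' s'" "norm_multiple r' s'"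
  shows "norm_multiple (r + r') (s + s')"
proof -
  have "quad_integral d r' (-s')" "norm_multiple r' (-s')"
    using assms by (simp_all add: quad_integral_def norm_multiple_def)
  from trace_mult_dvd[OF assms(1,2) this] obtain T
    where T: "2 * (r*r' + of_int d*s*(-s')) = of_int T" "p dvd T" .
  obtain n n' where "r^2 - of_int d * s^2 = of_int n" "p dvd n"
     "r'^2 - of_int d * s'^2 = of_int n'" "p dvd n'"
    using assms by (auto simp: norm_multiple_def)
  then show ?thesis
    unfolding norm_multiple_def quad_norm_add using T
    by (intro exI[of _ "n + n' + T"]) simp
qed

lemma norm_multiple_mult:
  assumes "quad_integral d r s" "norm_multiple r' s'"
  shows "norm_multiple (r*r' + of_int d*s*s') (r*s' + s*r')"
proof -
  obtain n n' where "r^2 - of_int d * s^2 = of_int n"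
     "r'^2 - of_int d * s'^2 = of_int n'" "p dvd n'"
    using assms by (auto simp: norm_multiple_def quad_integral_def elim!: Ints_cases)
  then show ?thesis
    unfolding norm_multiple_def quad_norm_mult by (intro exI[of _ "n * n'"]) simp
qed

lemma ramified_ideal_subset: "ramified_ideal \<subseteq> carrier OK"
  by (auto simp: ramified_ideal_def carrier_ring_of_integers)

lemma ramified_ideal_add: "x + y \<in> ramified_ideal"
  if "x \<in> ramified_ideal" "y \<in> ramified_ideal"
  using that quad_integral_add norm_multiple_add
  unfolding ramified_ideal_def by (auto simp: emb_add) blast

lemma ramified_ideal_mult: "x * y \<in> ramified_ideal"
  if "x \<in> carrier OK" "y \<in> ramified_ideal"
  using that quad_integral_mult norm_multiple_mult
  unfolding ramified_ideal_def carrier_ring_of_integers by (auto simp: emb_mult) blast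

lemma of_int_in_ramified_ideal: "of_int p \<in> ramified_ideal"
proof -
  have "norm_multiple (of_int p) 0"
    unfolding norm_multiple_def by (intro exI[of _ "p^2"]) simp
  then show ?thesis
    unfolding ramified_ideal_def using emb_of_int quad_integral_of_int by blast
qed

lemma sqrt_in_ramified_ideal: "w \<in> ramified_ideal"
proof -
  have "norm_multiple 0 1" using pd
    unfolding norm_multiple_def by (intro exI[of _ "- d"]) simp
  moreover have "quad_integral d 0 1" by (simp add: quad_integral_def)
  ultimately show ?thesis
    unfolding ramified_ideal_def using emb_w by blast
qed

lemma primeideal_ramified_ideal: "primeideal ramified_ideal OK"
proof (rule primeidealI)
  have minus: "- x \<in> ramified_ideal" if "x \<in> ramified_ideal" for x
    using ramified_ideal_mult[OF OK_of_int[of "-1"] that] by simp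
  show "ideal ramified_ideal OK"
  proof (rule idealI)
    show "subgroup ramified_ideal (add_monoid OK)"
    proof (rule OK.add.subgroupI)
      show "ramified_ideal \<noteq> {}" using sqrt_in_ramified_ideal by blast
      show "\<ominus>\<^bsub>OK\<^esub> x \<in> ramified_ideal" if "x \<in> ramified_ideal" for x
        using that minus ramified_ideal_subset by (auto simp: OK_a_inv)
    qed (use ramified_ideal_subset ramified_ideal_add in \<open>auto simp: OK_ops\<close>)
    show "x \<otimes>\<^bsub>OK\<^esub> y \<in> ramified_ideal" if "x \<in> ramified_ideal" "y \<in> carrier OK" for x y
      using ramified_ideal_mult[OF that(2,1)] by (simp add: OK_ops mult.commute)
  qed (simp_all add: OK_ops OK.ring_axioms ramified_ideal_mult)
  show "cring OK" by (rule cring_OK)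
  have "\<not> norm_multiple 1 0" using prime by (auto simp: norm_multiple_def)
  then have "1 \<notin> ramified_ideal"
    unfolding ramified_ideal_def emb_1 by (auto simp: emb_inject)
  then show "carrier OK \<noteq> ramified_ideal" using OK_of_int[of 1] by auto
  fix x y assume xy: "x \<in> carrier OK" "y \<in> carrier OK" "x \<otimes>\<^bsub>OK\<^esub> y \<in> ramified_ideal"
  obtain r s r' s' where x: "x = emb r s" "quad_integral d r s"
    and y: "y = emb r' s'" "quad_integral d r' s'"
    using xy by (auto simp: carrier_ring_of_integers)
  have "norm_multiple (r*r' + of_int d*s*s') (r*s' + s*r')"
    using xy(3) by (auto simp: OK_ops x y emb_mult ramified_ideal_def emb_inject)
  moreover obtain n n' where n: "r^2 - of_int d * s^2 = of_int n"
     "r'^2 - of_int d * s'^2 = of_int n'"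
    using x y by (auto simp: quad_integral_def elim!: Ints_cases)
  ultimately have "p dvd n * n'"
    unfolding norm_multiple_def quad_norm_mult n by (metis of_int_eq_iff of_int_mult)
  then have "norm_multiple r s \<or> norm_multiple r' s'"
    using prime n by (auto simp: norm_multiple_def prime_dvd_mult_iff)
  then show "x \<in> ramified_ideal \<or> y \<in> ramified_ideal"
    using x y by (auto simp: ramified_ideal_def)
qed

text \<open>The quotient of \<open>x * y\<close> by \<open>p\<close> is integral: its trace is
  \<open>T / p\<close> and its norm is \<open>(n / p) * (n' / p)\<close>.\<close>

lemma mult_in_PIdl:
  assumes "x \<in> ramified_ideal" "y \<in> ramified_ideal"
  shows "\<exists>z\<in>carrier OK. x * y = z * of_int p"
proof -
  have p0: "p \<noteq> 0" using prime by auto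
  obtain r s r' s' where x: "x = emb r s" "quad_integral d r s" "norm_multiple r s"
    and y: "y = emb r' s'" "quad_integral d r' s'" "norm_multiple r' s'"
    using assms by (auto simp: ramified_ideal_def)
  define a where a: "a = r*r' + of_int d*s*s'"
  define b where b: "b = r*s' + s*r'"
  obtain T where T: "2 * a = of_int T" "p dvd T"
    using trace_mult_dvd[OF x(2,3) y(2,3)] unfolding a .
  obtain n n' where n: "r^2 - of_int d * s^2 = of_int n" "p dvd n"
     "r'^2 - of_int d * s'^2 = of_int n'" "p dvd n'"
    using x y by (auto simp: norm_multiple_def)
  have N: "a^2 - of_int d * b^2 = of_int (n * n')"
    unfolding a b quad_norm_mult n by simp
  have "2 * (a / of_int p) \<in> \<int>"
  proof -
    obtain t where "T = p * t" using T(2) by (elim dvdE)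
    then have "2 * (a / of_int p) = of_int t" using T(1) p0 by (simp add: field_simps)
    then show ?thesis by simp
  qed
  moreover have "(a / of_int p)^2 - of_int d * (b / of_int p)^2 \<in> \<int>"
  proof -
    obtain k k' where k: "n = p * k" "n' = p * k'" using n by (auto elim!: dvdE)
    have "(a / of_int p)^2 - of_int d * (b / of_int p)^2 = (a^2 - of_int d * b^2) / (of_int p)^2"
      by (simp add: power_divide diff_divide_distrib)
    also have "\<dots> = of_int (k * k')"
      unfolding N k using p0 by (simp add: power2_eq_square)
    finally show ?thesis by (metis Ints_of_int)
  qed
  ultimately have "emb (a / of_int p) (b / of_int p) \<in> carrier OK"
    unfolding carrier_ring_of_integers quad_integral_def by blast
  moreover have "x * y = emb (a / of_int p) (b / of_int p) * of_int p"
    unfolding x y emb_of_int emb_mult emb_inject a[symmetric] b[symmetric] using p0 by simp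
  ultimately show ?thesis by blast
qed

lemma ramified_ideal_square:
  "ramified_ideal \<cdot>\<^bsub>OK\<^esub> ramified_ideal = PIdl\<^bsub>OK\<^esub> (of_int p)"
proof
  show "ramified_ideal \<cdot>\<^bsub>OK\<^esub> ramified_ideal \<subseteq> PIdl\<^bsub>OK\<^esub> (of_int p)"
  proof
    fix x assume "x \<in> ramified_ideal \<cdot>\<^bsub>OK\<^esub> ramified_ideal"
    then show "x \<in> PIdl\<^bsub>OK\<^esub> (of_int p)"
    proof (induction rule: ideal_prod.induct)
      case (prod i j)
      then show ?case using mult_in_PIdl by (auto simp: cgenideal_def OK_ops)
    next
      case (sum x y)
      then obtain a b where "a \<in> carrier OK" "b \<in> carrier OK" "x = a * of_int p" "y = b * of_int p"
        by (auto simp: cgenideal_def OK_ops)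
      then show ?case
        using OK_add[of a b] by (auto simp: cgenideal_def OK_ops distrib_right[symmetric])
    qed
  qed
  \<comment> \<open>For the other inclusion, \<open>p\<close> is the gcd of \<open>p^2\<close> and
    \<open>d = w^2\<close>, so Bezout writes it as a combination of the products
    \<open>p * p\<close> and \<open>w * w\<close> of elements of the ideal.\<close>
  obtain e where e: "d = p * e" "\<not> p dvd e"
    using pd by (auto simp: power2_eq_square)
  then have "coprime p e" using prime prime_imp_coprime by blast
  then obtain \<alpha> \<beta> where "\<alpha> * p + \<beta> * e = 1"
    by (metis bezout_int coprime_imp_gcd_eq_1)
  then have "p * (\<alpha> * p + \<beta> * e) = p" by simp
  then have "p = \<alpha> * p * p + \<beta> * d" unfolding e(1) by (simp add: algebra_simps)
  then have bez: "of_int p = of_int \<alpha> * of_int p * of_int p + of_int \<beta> * w * w"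
    using w2 by (metis of_int_add of_int_mult power2_eq_square mult.assoc)
  show "PIdl\<^bsub>OK\<^esub> (of_int p) \<subseteq> ramified_ideal \<cdot>\<^bsub>OK\<^esub> ramified_ideal"
  proof
    fix x assume "x \<in> PIdl\<^bsub>OK\<^esub> (of_int p)"
    then obtain z where z: "z \<in> carrier OK" "x = z * of_int p"
      by (auto simp: cgenideal_def OK_ops)
    have "x = (z * of_int \<alpha> * of_int p) * of_int p + (z * of_int \<beta> * w) * w"
      unfolding z by (subst bez) (simp add: algebra_simps)
    moreover have "z * of_int \<alpha> * of_int p \<in> ramified_ideal" "z * of_int \<beta> * w \<in> ramified_ideal"
      using z OK_of_int OK_mult ramified_ideal_mult of_int_in_ramified_ideal sqrt_in_ramified_ideal
      by auto
    ultimately show "x \<in> ramified_ideal \<cdot>\<^bsub>OK\<^esub> ramified_ideal"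
      using ideal_prod.sum[OF ideal_prod.prod ideal_prod.prod, of _ ramified_ideal _ ramified_ideal _ _ OK]
        of_int_in_ramified_ideal sqrt_in_ramified_ideal
      by (simp add: OK_ops)
  qed
qed

lemma ramifies_in_rat_adjoin: "ramifies_in (nat p) (rat_adjoin {w})"
proof -
  have "p \<ge> 0" using prime prime_ge_0_int by blast
  then have p: "of_nat (nat p) = (of_int p :: complex)" by simp
  have I: "ideal ramified_ideal OK" using primeideal_ramified_ideal by (rule primeideal.axioms)
  \<comment> \<open>The principal ideal equals the square of the prime, so the cofactor
    \<open>J\<close> is the whole ring.\<close>
  have "PIdl\<^bsub>OK\<^esub> (of_int p) = (ramified_ideal \<cdot>\<^bsub>OK\<^esub> ramified_ideal) \<cdot>\<^bsub>OK\<^esub> carrier OK"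
    using OK.ideal_prod_one[OF OK.ideal_prod_is_ideal[OF I I]] ramified_ideal_square by simp
  then show ?thesis
    unfolding ramifies_in_def p using primeideal_ramified_ideal OK.oneideal by blast
qed

section \<open>Infinitely many distinct fields\<close>

text \<open>If \<open>z = r + s*w\<close>, comparing coordinates of \<open>z^2\<close> gives
  \<open>r * s = 0\<close>, so \<open>k\<close> is \<open>r^2\<close> or \<open>d * s^2\<close>.
  Both contradict that \<open>l\<close> divides \<open>k\<close> exactly once and does not divide
  \<open>d\<close>.\<close>

lemma rat_adjoin_sqrt_neq:
  assumes z: "z^2 = of_int k" and l: "prime l" "l dvd k" "\<not> l^2 dvd k" "\<not> l dvd d"
  shows "rat_adjoin {z} \<noteq> rat_adjoin {w}"
proof
  assume "rat_adjoin {z} = rat_adjoin {w}"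
  moreover have "z \<in> rat_adjoin {z}"
    unfolding rat_adjoin_def by (rule generate_field.incl) simp
  ultimately obtain r s where rs: "z = emb r s" by (auto simp: rat_adjoin_sqrt)
  have "emb r s * emb r s = emb (of_int k) 0"
    using z by (simp add: rs power2_eq_square flip: emb_of_int)
  then have "r*r + of_int d*s*s = of_int k" "r * s = 0"
    unfolding emb_mult emb_inject by simp_all
  then have "r^2 * of_int 1 = of_int k \<or> s^2 * of_int d = of_int k"
    by (auto simp: power2_eq_square mult_ac)
  moreover have "\<not> l dvd 1" using l(1) by auto
  ultimately show False
    using rat_square_times_nonmultiple[OF l(1-3)] l(4) by blast
qed

end

text \<open>A variant of Euclid's argument, with \<open>M\<close> collecting the primes to be
  avoided.\<close>

lemma exists_prime_QuadRes:
  fixes a M :: int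
  assumes "a \<noteq> 0" "M \<noteq> 0"
  obtains l where "prime l" "l \<noteq> 2" "QuadRes l a" "\<not> l dvd M"
proof -
  \<comment> \<open>\<open>(2 a M)\<^sup>2 - a = a n\<close>, and \<open>n\<close> is coprime to \<open>2 M\<close>.\<close>
  define n where "n = 4 * a * M^2 - 1"
  have "\<not> is_unit n"
  proof
    assume "is_unit n"
    then have "\<bar>4 * (a * M^2) - 1\<bar> = 1" by (simp add: n_def mult.assoc)
    then have "a * M^2 = 0" by presburger
    then show False using assms by simp
  qed
  moreover have "odd n" by (simp add: n_def)
  then have "n \<noteq> 0" by auto
  ultimately obtain l where l: "prime l" "l dvd n" by (metis prime_divisorE)
  have "\<not> l dvd 4 * a * M^2"
    using l unfolding n_def by (metis dvd_diff_right_iff not_prime_unit)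
  then have "l \<noteq> 2" "\<not> l dvd M" by (auto simp: power2_eq_square)
  moreover have "l dvd (2*a*M)^2 - a"
  proof -
    have "(2*a*M)^2 - a = a * n" by (simp add: n_def power2_eq_square algebra_simps)
    then show ?thesis using l by simp
  qed
  then have "QuadRes l a" by (auto simp: QuadRes_def cong_iff_dvd_diff)
  ultimately show ?thesis using l that by blast
qed

theorem theorem2p12:
  fixes N :: nat and a :: int and p :: nat
  assumes "(N, a) \<in> {(28, -7), (30, 5), (33, -11), (35, 5)}"
    and "prime p" and "p \<noteq> 2"
    and "QuadRes (int p) a"
  shows "infinite {K. \<exists>u::int. \<not> is_square (f_X0 N u) \<and>
           K = rat_adjoin {csqrt (f_X0 N (of_int u))} \<and> ramifies_in p K}"
proof -
  define w :: "int \<Rightarrow> complex" where "w u = csqrt (f_X0 N (of_int u))" for u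
  define F where "F u = rat_adjoin {w u}" for u
  \<comment> \<open>Exact divisibility by \<open>p\<close> yields both non-squareness and
    ramification, so it suffices that \<open>F\<close> takes infinitely many values on
    \<open>U\<close>.\<close>
  define U where "U = {u. int p dvd f_X0 N u \<and> \<not> (int p)^2 dvd f_X0 N u}"
  have N: "N \<in> {28, 30, 33, 35}" and a: "a \<noteq> 0" using assms(1) by auto
  have p: "prime (int p)" "int p \<noteq> 2" using assms(2,3) by auto
  have w2: "(w u)^2 = of_int (f_X0 N u)" for u
    by (simp add: w_def f_X0_of_int[OF N])
  have ram: "ramified_sqrt (f_X0 N u) (int p) (w u)" if "u \<in> U" for u
    using that w2 p by unfold_locales (auto simp: U_def)
  have "infinite (F ` U)"
  proof
    assume "finite (F ` U)"
    then obtain V where V: "V \<subseteq> U" "finite V" "F ` U = F ` V"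
      using finite_subset_image[of "F ` U" F U] by auto
    \<comment> \<open>The factor \<open>int p\<close> forces \<open>l\<close> to differ from
      \<open>p\<close>, as the Chinese remainder theorem requires; the product keeps
      \<open>l\<close> from dividing the values at the representatives in \<open>V\<close>.\<close>
    define M where "M = int p * (\<Prod>u\<in>V. f_X0 N u)"
    have "f_X0 N u \<noteq> 0" if "u \<in> V" for u using that V(1) by (auto simp: U_def)
    then have "M \<noteq> 0" using V(2) p by (auto simp: M_def)
    then obtain l where l: "prime l" "l \<noteq> 2" "QuadRes l a" "\<not> l dvd M"
      using exists_prime_QuadRes a by blast
    obtain u1 where u1: "int p dvd f_X0 N u1" "\<not> (int p)^2 dvd f_X0 N u1"
      using exact_divisor_f_X0[OF assms(1) p assms(4)] by blast
    obtain u2 where u2: "l dvd f_X0 N u2" "\<not> l^2 dvd f_X0 N u2"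
      using exact_divisor_f_X0[OF assms(1) l(1-3)] by blast
    have "\<not> l dvd int p" using l(4) by (auto simp: M_def)
    then have "coprime ((int p)^2) (l^2)"
      using l(1) by (simp add: prime_imp_coprime coprime_commute)
    then obtain u where u: "[u = u1] (mod (int p)^2)" "[u = u2] (mod l^2)"
      using binary_chinese_remainder_int by blast
    \<comment> \<open>Exact divisibility by \<open>m\<close> depends only on the argument modulo
      \<open>m^2\<close>, hence the congruences modulo squares.\<close>
    have lift: "m dvd f_X0 N u" "\<not> m^2 dvd f_X0 N u"
      if "m dvd f_X0 N v" "\<not> m^2 dvd f_X0 N v" "[u = v] (mod m^2)" for m v :: int
    proof -
      have *: "[f_X0 N u = f_X0 N v] (mod m^2)" by (rule cong_f_X0[OF N that(3)])
      then show "\<not> m^2 dvd f_X0 N u" using that(2) cong_dvd_iff by blast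
      have "[f_X0 N u = f_X0 N v] (mod m)" using * by (rule cong_dvd_modulus) simp
      then show "m dvd f_X0 N u" using that(1) cong_dvd_iff by blast
    qed
    have "u \<in> U" using lift[OF u1 u(1)] by (simp add: U_def)
    then obtain v where v: "v \<in> V" "F u = F v"
      using V(3) by blast
    have "\<not> l dvd f_X0 N v" using l(4) v(1) V(2) unfolding M_def
      by (metis dvd_mult dvd_prodI dvd_trans)
    then show False
      using ramified_sqrt.rat_adjoin_sqrt_neq[OF ram w2 l(1) lift[OF u2 u(2)]] v V(1)
      unfolding F_def by blast
  qed
  moreover have "\<not> is_square (f_X0 N u)" if "u \<in> U" for u
  proof
    assume "is_square (f_X0 N u)"
    then obtain k where "f_X0 N u = k^2" by (elim is_nth_powerE)
    then show False using that prime_dvd_power[OF p(1), of k 2] by (auto simp: U_def)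
  qed
  moreover have "ramifies_in p (F u)" if "u \<in> U" for u
    using ramified_sqrt.ramifies_in_rat_adjoin[OF ram[OF that]] by (simp add: F_def)
  ultimately show ?thesis
    by (elim infinite_super[rotated]) (auto simp: F_def w_def)
qed

end
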